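(* Let $f$ be a strictly monotone parameter on marked groups. Then there is a family $\{(G_\omega,S_\omega)\}$ of marked groups such that the set of values $\{f(G_\omega,S_\omega)\}$ has the cardinality of the continuum.
   Context: A marked group $(G,S)$ is a group $G$ with an ordered finite symmetric generating set $S=\{s_1,\dots,s_k\}$, $S=S^{-1}$; equivalently an epimorphism $\mathbf F_k\to G$ from the free group sending the $i$-th free generator to $s_i$. For $N\lhd G$, the projection $S'$ of $S$ onto $G/N$ is the ordered $k$-tuple of images of the $s_i$ (counted with multiplicity). Marked groups $(G_n,S_n)$ converge to $(G,S)$ in the Chabauty topology if for every $r$, for all sufficiently large $n$ the balls of radius $r$ in $(G_n,S_n)$ and $(G,S)$ coincide, i.e. $\ker(\mathbf F_k\to G_n)$ and $\ker(\mathbf F_k\to G)$ have the same intersection with the ball of radius $r$ in $\mathbf F_k$. A parameter is a real-valued function $f$ on marked groups. It is decreasing if (1) $f(G/N,S')\ge f(G,S)$ for all $N\lhd G$, and (2) $(G_n,S_n)\to(G,S)$ implies $\limsup_n f(G_n,S_n)\ge f(G,S)$. It is increasing if (1) and (2) hold with the inequalities reversed, i.e. $f(G/N,S')\le f(G,S)$ and $\limsup_n f(G_n,S_n)\le f(G,S)$. It is monotone if it is increasing or decreasing. It is strictly monotone if it is monotone and moreover the inequality in (1) is strict whenever $N$ is nonamenable. *)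

theory Defs
  imports "HOL-Algebra.Coset" "HOL-Algebra.Generated_Groups"
    "HOL-Library.Equipollence" "HOL-Library.Extended_Real"
begin

text \<open>
  The generating tuple is a list, so its entries are ordered and may repeat (as they do in
  quotients); only the set of its entries is required to be symmetric.
\<close>

definition marked_group :: "'a monoid \<Rightarrow> 'a list \<Rightarrow> bool" where
  "marked_group G S \<longleftrightarrow>
     group G \<and> set S \<subseteq> carrier G \<and> (\<lambda>s. inv\<^bsub>G\<^esub> s) ` set S = set S \<and>
     generate G (set S) = carrier G"

definition marked_iso :: "'a monoid \<Rightarrow> 'a list \<Rightarrow> 'b monoid \<Rightarrow> 'b list \<Rightarrow> bool" where
  "marked_iso G S H T \<longleftrightarrow> (\<exists>\<phi>\<in>iso G H. map \<phi> S = T)"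

definition quotient_marking :: "'a monoid \<Rightarrow> 'a list \<Rightarrow> 'a set \<Rightarrow> 'a set list" where
  "quotient_marking G S N = map (\<lambda>s. N #>\<^bsub>G\<^esub> s) S"

text \<open>
  The carrier of \<^term>\<open>G Mod N\<close> consists of sets of elements of \<open>G\<close>, so it does not live in the
  element type of \<open>G\<close>.  A parameter is evaluated on marked groups over one fixed infinite type
  (on which every finitely generated group, being countable, has an isomorphic copy), and the
  following says that \<open>(H, T)\<close> is a copy of \<open>(G/N, S')\<close> over that type.
\<close>

definition is_marked_quotient ::
  "'a monoid \<Rightarrow> 'a list \<Rightarrow> 'a set \<Rightarrow> 'a monoid \<Rightarrow> 'a list \<Rightarrow> bool" where
  "is_marked_quotient G S N H T \<longleftrightarrow>
     marked_group G S \<and> N \<lhd> G \<and> marked_group H T \<and>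
     marked_iso (G Mod N) (quotient_marking G S N) H T"

text \<open>
  Elements of the free group of rank \<open>k\<close> are represented by reduced words; the letter
  \<open>(i, True)\<close> is the \<open>i\<close>-th free generator (counted from 0) and \<open>(i, False)\<close> is its inverse.
  Word length in the free generators is then the length of the list.
\<close>

definition free_group_elems :: "nat \<Rightarrow> (nat \<times> bool) list set" where
  "free_group_elems k =
     {w. set w \<subseteq> {..<k} \<times> UNIV \<and>
         successively (\<lambda>x y. fst x = fst y \<longrightarrow> snd x = snd y) w}"

definition free_group_ball :: "nat \<Rightarrow> nat \<Rightarrow> (nat \<times> bool) list set" where
  "free_group_ball k r = {w \<in> free_group_elems k. length w \<le> r}"

definition word_value :: "'a monoid \<Rightarrow> 'a list \<Rightarrow> (nat \<times> bool) list \<Rightarrow> 'a" where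
  "word_value G S w =
     foldr (\<lambda>(i, b) g. (if b then S ! i else inv\<^bsub>G\<^esub> (S ! i)) \<otimes>\<^bsub>G\<^esub> g) w \<one>\<^bsub>G\<^esub>"

definition marking_kernel :: "'a monoid \<Rightarrow> 'a list \<Rightarrow> (nat \<times> bool) list set" where
  "marking_kernel G S = {w \<in> free_group_elems (length S). word_value G S w = \<one>\<^bsub>G\<^esub>}"

definition chabauty_converges ::
  "(nat \<Rightarrow> 'a monoid) \<Rightarrow> (nat \<Rightarrow> 'a list) \<Rightarrow> 'a monoid \<Rightarrow> 'a list \<Rightarrow> bool" where
  "chabauty_converges Gs Ss G S \<longleftrightarrow>
     (\<forall>r. \<forall>\<^sub>F n in sequentially.
        length (Ss n) = length S \<and>
        marking_kernel (Gs n) (Ss n) \<inter> free_group_ball (length S) r =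
        marking_kernel G S \<inter> free_group_ball (length S) r)"

text \<open>
  Amenability of a discrete group: existence of a left-invariant, finitely additive probability
  measure defined on all subsets.
\<close>

definition amenable :: "'a monoid \<Rightarrow> bool" where
  "amenable G \<longleftrightarrow>
     (\<exists>\<mu> :: 'a set \<Rightarrow> real.
        \<mu> (carrier G) = 1 \<and>
        (\<forall>A\<subseteq>carrier G. 0 \<le> \<mu> A) \<and>
        (\<forall>A\<subseteq>carrier G. \<forall>B\<subseteq>carrier G. A \<inter> B = {} \<longrightarrow> \<mu> (A \<union> B) = \<mu> A + \<mu> B) \<and>
        (\<forall>g\<in>carrier G. \<forall>A\<subseteq>carrier G. \<mu> (g <#\<^bsub>G\<^esub> A) = \<mu> A))"

text \<open>
  The upper limits are taken in the extended reals, as the sequences need not be bounded.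
  Invariance of a parameter under marked isomorphism is not required separately: it follows from
  either clause (trivial \<open>N\<close>, or constant sequences).
\<close>

definition decreasing_parameter :: "('a monoid \<Rightarrow> 'a list \<Rightarrow> real) \<Rightarrow> bool" where
  "decreasing_parameter f \<longleftrightarrow>
     (\<forall>G S N H T. is_marked_quotient G S N H T \<longrightarrow> f H T \<ge> f G S) \<and>
     (\<forall>Gs Ss G S. (\<forall>n. marked_group (Gs n) (Ss n)) \<longrightarrow> marked_group G S \<longrightarrow>
        chabauty_converges Gs Ss G S \<longrightarrow>
        limsup (\<lambda>n. ereal (f (Gs n) (Ss n))) \<ge> ereal (f G S))"

definition increasing_parameter :: "('a monoid \<Rightarrow> 'a list \<Rightarrow> real) \<Rightarrow> bool" where
  "increasing_parameter f \<longleftrightarrow>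
     (\<forall>G S N H T. is_marked_quotient G S N H T \<longrightarrow> f H T \<le> f G S) \<and>
     (\<forall>Gs Ss G S. (\<forall>n. marked_group (Gs n) (Ss n)) \<longrightarrow> marked_group G S \<longrightarrow>
        chabauty_converges Gs Ss G S \<longrightarrow>
        limsup (\<lambda>n. ereal (f (Gs n) (Ss n))) \<le> ereal (f G S))"

definition strictly_monotone_parameter :: "('a monoid \<Rightarrow> 'a list \<Rightarrow> real) \<Rightarrow> bool" where
  "strictly_monotone_parameter f \<longleftrightarrow>
     (decreasing_parameter f \<and>
       (\<forall>G S N H T. is_marked_quotient G S N H T \<longrightarrow> \<not> amenable (G\<lparr>carrier := N\<rparr>) \<longrightarrow>
          f H T > f G S)) \<or>
     (increasing_parameter f \<and>
       (\<forall>G S N H T. is_marked_quotient G S N H T \<longrightarrow> \<not> amenable (G\<lparr>carrier := N\<rparr>) \<longrightarrow>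
          f H T < f G S))"

end

theory Submission
  imports Defs "HOL-Library.Countable_Set"
begin

text \<open>
  For \<open>W \<subseteq> \<nat>\<close> let a fixed finite set of letters act on \<open>\<nat> \<times> \<int> \<times> \<rat>\<close>: one letter
  shifts \<open>\<int>\<close>, two letters act on the fibres \<open>(n, 0)\<close> with \<open>n \<in> W\<close> by \<open>x \<mapsto> 2x\<close> and \<open>x \<mapsto> 1/x\<close>, and one
  letter acts on the fibres \<open>(n, n)\<close> with \<open>n \<in> W\<close> by \<open>x \<mapsto> x + 1\<close>.  The group generated shrinks to a quotient when \<open>W\<close> shrinks.  Since
  \<open>x + 1\<close> is a commutator of the doubling and itself, the commutator of the doubling with the
  \<open>n\<close>-fold shift of the increment is \<open>x + 1\<close> on the single fibre \<open>(n, 0)\<close> and the identity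
  elsewhere.  So if \<open>n\<close> is removed from \<open>W\<close>, then the kernel contains \<open>x + 1\<close> and
  \<open>1/(1/x + 1)\<close> on that fibre, and these two maps leave no mean on \<open>\<rat>\<close> invariant.  A chain of
  subsets of \<open>\<nat>\<close> of the order type of the reals then gives an injective family of values.
\<close>

section \<open>A criterion for nonamenability\<close>

text \<open>
  \<open>x + 1\<close> and \<open>1/(1/x + 1)\<close> map the positive rationals into disjoint subsets of the positive
  rationals, and their inverses do the same with the negative ones; so a mean must be concentrated
  at \<open>0\<close>, which \<open>x + 1\<close> moves.
\<close>

lemma not_amenable_if_parabolic_pair:
  fixes K :: "'a monoid" and \<theta> :: "'a \<Rightarrow> rat"
  assumes "group K" and p: "p \<in> carrier K" and q: "q \<in> carrier K"
    and \<theta>p: "\<And>g. g \<in> carrier K \<Longrightarrow> \<theta> (p \<otimes>\<^bsub>K\<^esub> g) = \<theta> g + 1"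
    and \<theta>q: "\<And>g. g \<in> carrier K \<Longrightarrow> \<theta> (q \<otimes>\<^bsub>K\<^esub> g) = inverse (inverse (\<theta> g) + 1)"
  shows "\<not> amenable K"
proof
  interpret group K by fact
  assume "amenable K"
  then obtain \<mu> :: "'a set \<Rightarrow> real"
    where one: "\<mu> (carrier K) = 1"
      and n: "\<forall>A\<subseteq>carrier K. 0 \<le> \<mu> A"
      and a: "\<forall>A\<subseteq>carrier K. \<forall>B\<subseteq>carrier K. A \<inter> B = {} \<longrightarrow> \<mu> (A \<union> B) = \<mu> A + \<mu> B"
      and i: "\<forall>g\<in>carrier K. \<forall>A\<subseteq>carrier K. \<mu> (g <#\<^bsub>K\<^esub> A) = \<mu> A"
    unfolding amenable_def by (elim exE conjE)
  have nonneg: "0 \<le> \<mu> A" if "A \<subseteq> carrier K" for A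
    using n that by blast
  have add: "\<mu> (A \<union> B) = \<mu> A + \<mu> B" if "A \<subseteq> carrier K" "B \<subseteq> carrier K" "A \<inter> B = {}" for A B
    using a that by blast
  have invariant: "\<mu> (g <#\<^bsub>K\<^esub> A) = \<mu> A" if "g \<in> carrier K" "A \<subseteq> carrier K" for g A
    using i that by blast
  \<comment> \<open>Preimages under \<open>\<theta>\<close> transport the mean to
    \<open>\<rat>\<close>: \<open>X \<mapsto> \<mu> (M X)\<close> is a finitely additive measure on
    sets of rationals.\<close>
  define M where "M X = {g \<in> carrier K. \<theta> g \<in> X}" for X
  have M: "M X \<subseteq> carrier K" for X by (auto simp: M_def)
  have mono: "\<mu> (M X) \<le> \<mu> (M Y)" if "X \<subseteq> Y" for X Y
  proof -
    have "M Y = M X \<union> M (Y - X)" "M X \<inter> M (Y - X) = {}" using that by (auto simp: M_def)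
    then show ?thesis using add[OF M M, of X "Y - X"] nonneg[OF M, of "Y - X"] by simp
  qed
  have disj: "\<mu> (M (X \<union> Y)) = \<mu> (M X) + \<mu> (M Y)" if "X \<inter> Y = {}" for X Y
  proof -
    have "M (X \<union> Y) = M X \<union> M Y" "M X \<inter> M Y = {}" using that by (auto simp: M_def)
    then show ?thesis using add[OF M M] by simp
  qed
  have push: "\<mu> (M X) \<le> \<mu> (M Y)"
    if h: "h \<in> carrier K" and XY: "\<And>g. g \<in> carrier K \<Longrightarrow> \<theta> g \<in> X \<Longrightarrow> \<theta> (h \<otimes>\<^bsub>K\<^esub> g) \<in> Y" for h X Y
  proof -
    have sub: "h <#\<^bsub>K\<^esub> M X \<subseteq> M Y" using h XY by (auto simp: M_def l_coset_def)
    then have "M Y = (h <#\<^bsub>K\<^esub> M X) \<union> (M Y - (h <#\<^bsub>K\<^esub> M X))" by blast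
    then have "\<mu> (M Y) = \<mu> (h <#\<^bsub>K\<^esub> M X) + \<mu> (M Y - (h <#\<^bsub>K\<^esub> M X))"
      using add[of "h <#\<^bsub>K\<^esub> M X" "M Y - (h <#\<^bsub>K\<^esub> M X)"] sub M by (metis Diff_disjoint Diff_subset order_trans)
    moreover have "0 \<le> \<mu> (M Y - (h <#\<^bsub>K\<^esub> M X))" using nonneg M by (meson Diff_subset order_trans)
    ultimately show ?thesis using invariant[OF h M] by simp
  qed
  have \<theta>p': "\<theta> (inv\<^bsub>K\<^esub> p \<otimes>\<^bsub>K\<^esub> g) = \<theta> g - 1" if g: "g \<in> carrier K" for g
  proof -
    have "\<theta> (p \<otimes>\<^bsub>K\<^esub> (inv\<^bsub>K\<^esub> p \<otimes>\<^bsub>K\<^esub> g)) = \<theta> (inv\<^bsub>K\<^esub> p \<otimes>\<^bsub>K\<^esub> g) + 1" using \<theta>p p g by simp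
    then show ?thesis using p g by (simp add: m_assoc[symmetric])
  qed
  have \<theta>q': "\<theta> (inv\<^bsub>K\<^esub> q \<otimes>\<^bsub>K\<^esub> g) = inverse (inverse (\<theta> g) - 1)" if g: "g \<in> carrier K" for g
  proof -
    have "\<theta> (q \<otimes>\<^bsub>K\<^esub> (inv\<^bsub>K\<^esub> q \<otimes>\<^bsub>K\<^esub> g)) = inverse (inverse (\<theta> (inv\<^bsub>K\<^esub> q \<otimes>\<^bsub>K\<^esub> g)) + 1)" using \<theta>q q g by simp
    then have "\<theta> g = inverse (inverse (\<theta> (inv\<^bsub>K\<^esub> q \<otimes>\<^bsub>K\<^esub> g)) + 1)"
      using q g by (simp add: m_assoc[symmetric])
    \<comment> \<open>As \<open>inverse 0 = 0\<close>, \<open>inverse\<close> is an involution of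
      all of \<open>\<rat>\<close>, and no case of a zero value splits off.\<close>
    then have "inverse (\<theta> g) - 1 = inverse (\<theta> (inv\<^bsub>K\<^esub> q \<otimes>\<^bsub>K\<^esub> g))" by simp
    then show ?thesis by simp
  qed
  have pos: "\<mu> (M {0<..}) = 0"
  proof -
    have "\<mu> (M {0<..}) \<le> \<mu> (M {1<..})" by (rule push[OF p]) (simp add: \<theta>p)
    moreover have "\<mu> (M {0<..}) \<le> \<mu> (M {0<..<1})"
      by (rule push[OF q]) (simp add: \<theta>q add_pos_pos inverse_less_1_iff)
    moreover have "\<mu> (M {1<..}) + \<mu> (M {0<..<1}) = \<mu> (M ({1<..} \<union> {0<..<1}))"
      by (rule disj[symmetric]) auto
    moreover have "\<dots> \<le> \<mu> (M {0<..})" by (rule mono) auto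
    ultimately show ?thesis using nonneg[OF M, of "{0<..}"] by linarith
  qed
  have neg: "\<mu> (M {..<0}) = 0"
  proof -
    \<comment> \<open>Conjugation by \<open>x \<mapsto> -x\<close> turns the inverse of the second
      map into that map, so the bound for positive arguments applies to \<open>-x\<close>.\<close>
    have minus: "inverse (inverse x - 1) \<in> {-1<..<0}" if "x < 0" for x :: rat
    proof -
      have "inverse (inverse (-x) + 1) \<in> {0<..<1}"
        using that by (simp add: add_pos_pos inverse_less_1_iff del: inverse_minus_eq)
      moreover have "inverse (inverse (-x) + 1) = - inverse (inverse x - 1)"
        by (metis inverse_minus_eq minus_diff_eq uminus_add_conv_diff add.commute)
      ultimately show ?thesis by simp
    qed
    have "\<mu> (M {..<0}) \<le> \<mu> (M {..<-1})"
      by (rule push[of "inv\<^bsub>K\<^esub> p"]) (simp_all add: \<theta>p' p)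
    moreover have "\<mu> (M {..<0}) \<le> \<mu> (M {-1<..<0})"
      by (rule push[of "inv\<^bsub>K\<^esub> q"]) (use minus in \<open>simp_all add: \<theta>q' q\<close>)
    moreover have "\<mu> (M {..<-1}) + \<mu> (M {-1<..<0}) = \<mu> (M ({..<-1} \<union> {-1<..<0}))"
      by (rule disj[symmetric]) auto
    moreover have "\<dots> \<le> \<mu> (M {..<0})" by (rule mono) auto
    ultimately show ?thesis using nonneg[OF M, of "{..<0}"] by linarith
  qed
  have "\<mu> (M {0}) \<le> \<mu> (M {0<..})" by (rule push[OF p]) (simp add: \<theta>p)
  then have zero: "\<mu> (M {0}) = 0" using pos nonneg[OF M, of "{0}"] by simp
  have "M ({..<0} \<union> ({0} \<union> {0<..})) = carrier K" by (auto simp: M_def)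
  moreover have "\<mu> (M ({..<0} \<union> ({0} \<union> {0<..}))) = \<mu> (M {..<0}) + (\<mu> (M {0}) + \<mu> (M {0<..}))"
    by (subst disj, force, subst disj) auto
  ultimately show False using one pos neg zero by simp
qed

section \<open>Groups of words\<close>

text \<open>The free monoid on the letters modulo equality of values under \<open>ev\<close>. The
  values themselves serve as elements, so the group lives over any type able to hold them; products
  go through chosen words, a choice that \<open>cong\<close> below makes harmless.\<close>

definition word_group :: "('l list \<Rightarrow> 'a) \<Rightarrow> 'a monoid" where
  "word_group ev =
     \<lparr>carrier = range ev,
      monoid.mult = (\<lambda>a b. ev (inv_into UNIV ev a @ inv_into UNIV ev b)),
      one = ev []\<rparr>"

locale word_evaluation =
  fixes ev :: "'l list \<Rightarrow> 'a" and bar :: "'l \<Rightarrow> 'l"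
  assumes cong: "ev u = ev u' \<Longrightarrow> ev v = ev v' \<Longrightarrow> ev (u @ v) = ev (u' @ v')"
    and bar_left: "ev [bar l, l] = ev []"
    and bar_bar: "bar (bar l) = l"
begin

lemma carrier_eq: "carrier (word_group ev) = range ev"
  and one_eq: "\<one>\<^bsub>word_group ev\<^esub> = ev []"
  by (simp_all add: word_group_def)

lemma ev_mult: "ev u \<otimes>\<^bsub>word_group ev\<^esub> ev v = ev (u @ v)"
  unfolding word_group_def by (simp, rule cong) (simp_all add: f_inv_into_f)

lemma ev_inverse: "ev (rev (map bar w) @ w) = ev []"
proof (induction w)
  case (Cons l w)
  have "ev ([bar l, l] @ w) = ev ([] @ w)" by (rule cong[OF bar_left refl])
  from cong[OF refl this, of "rev (map bar w)"] show ?case using Cons.IH by simp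
qed simp

lemma group_word_group: "group (word_group ev)"
proof (rule groupI)
  fix x assume "x \<in> carrier (word_group ev)"
  then obtain w where w: "x = ev w" by (auto simp: carrier_eq)
  show "\<exists>y\<in>carrier (word_group ev). y \<otimes>\<^bsub>word_group ev\<^esub> x = \<one>\<^bsub>word_group ev\<^esub>"
    by (rule bexI[of _ "ev (rev (map bar w))"]) (simp_all add: w ev_mult ev_inverse one_eq carrier_eq)
qed (auto simp: carrier_eq one_eq ev_mult)

lemma inv_letter: "inv\<^bsub>word_group ev\<^esub> (ev [l]) = ev [bar l]"
proof -
  interpret group "word_group ev" by (rule group_word_group)
  show ?thesis by (rule inv_equality) (simp_all add: carrier_eq ev_mult bar_left one_eq)
qed

lemma marked_group_word_group:
  assumes "set ls = UNIV"
  shows "marked_group (word_group ev) (map (\<lambda>l. ev [l]) ls)"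
proof -
  interpret group "word_group ev" by (rule group_word_group)
  have S: "set (map (\<lambda>l. ev [l]) ls) = range (\<lambda>l. ev [l])" using assms by simp
  \<comment> \<open>Every letter is the bar of its own bar, so inversion maps the set of generators
    onto itself.\<close>
  have sym: "(\<lambda>s. inv\<^bsub>word_group ev\<^esub> s) ` range (\<lambda>l. ev [l]) = range (\<lambda>l. ev [l])"
    by (auto simp: image_image inv_letter) (metis bar_bar rangeI)
  have "ev w \<in> generate (word_group ev) (range (\<lambda>l. ev [l]))" for w
  proof (induction w)
    case Nil
    show ?case using generate.one[of "word_group ev"] by (simp add: one_eq)
  next
    case (Cons l w)
    have "ev [l] \<otimes>\<^bsub>word_group ev\<^esub> ev w \<in> generate (word_group ev) (range (\<lambda>l. ev [l]))"
      by (rule generate.eng[OF generate.incl Cons.IH]) simp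
    then show ?case by (simp add: ev_mult)
  qed
  moreover have "generate (word_group ev) (range (\<lambda>l. ev [l])) \<subseteq> carrier (word_group ev)"
    by (rule generate_incl) (auto simp: carrier_eq)
  ultimately have "generate (word_group ev) (range (\<lambda>l. ev [l])) = carrier (word_group ev)"
    by (auto simp: carrier_eq)
  then show ?thesis unfolding marked_group_def S using sym by (auto simp: carrier_eq)
qed

end

text \<open>By \<open>factor\<close>, \<open>ev w \<mapsto> ev' w\<close> is a well-defined
  epimorphism \<open>h\<close>. The displayed set is its kernel, and the first isomorphism theorem
  sends the coset of each generator to the generator of the same letter.\<close>

lemma is_marked_quotient_word_group:
  fixes ev ev' :: "'l list \<Rightarrow> 'a"
  assumes "word_evaluation ev bar" "word_evaluation ev' bar" and ls: "set ls = UNIV"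
    and factor: "\<And>u v. ev u = ev v \<Longrightarrow> ev' u = ev' v"
  shows "is_marked_quotient (word_group ev) (map (\<lambda>l. ev [l]) ls) {ev w | w. ev' w = ev' []}
           (word_group ev') (map (\<lambda>l. ev' [l]) ls)"
proof -
  let ?G = "word_group ev" and ?H = "word_group ev'"
  interpret G: word_evaluation ev bar by fact
  interpret H: word_evaluation ev' bar by fact
  define h where "h x = ev' (inv_into UNIV ev x)" for x
  have h: "h (ev w) = ev' w" for w unfolding h_def by (rule factor) (simp add: f_inv_into_f)
  interpret group_hom ?G ?H h
    by (auto simp: group_hom_def group_hom_axioms_def G.group_word_group H.group_word_group
        hom_def G.carrier_eq H.carrier_eq G.ev_mult H.ev_mult h)
  have N: "{ev w | w. ev' w = ev' []} = kernel ?G ?H h"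
    by (auto simp: kernel_def G.carrier_eq H.one_eq h)
  have "h ` carrier ?G = carrier ?H" by (auto simp: G.carrier_eq H.carrier_eq h image_image)
  then have iso: "(\<lambda>X. the_elem (h ` X)) \<in> iso (?G Mod kernel ?G ?H h) ?H"
    by (rule FactGroup_iso_set)
  have coset: "the_elem (h ` (kernel ?G ?H h #>\<^bsub>?G\<^esub> x)) = h x" if x: "x \<in> carrier ?G" for x
  proof -
    have "h (k \<otimes>\<^bsub>?G\<^esub> x) = h x" if "k \<in> kernel ?G ?H h" for k
      using that x by (auto simp: kernel_def)
    moreover have "\<one>\<^bsub>?G\<^esub> \<in> kernel ?G ?H h" by (simp add: kernel_def)
    ultimately have "h ` (kernel ?G ?H h #>\<^bsub>?G\<^esub> x) = (\<lambda>_. h x) ` kernel ?G ?H h"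
      by (simp add: r_coset_def UNION_singleton_eq_range image_image cong: image_cong)
    also have "\<dots> = {h x}" using \<open>\<one>\<^bsub>?G\<^esub> \<in> kernel ?G ?H h\<close> by (rule image_constant)
    finally show ?thesis by simp
  qed
  have "map (\<lambda>X. the_elem (h ` X)) (quotient_marking ?G (map (\<lambda>l. ev [l]) ls) (kernel ?G ?H h))
      = map (\<lambda>l. ev' [l]) ls"
    by (simp add: quotient_marking_def coset G.carrier_eq h)
  then show ?thesis unfolding is_marked_quotient_def marked_iso_def N
    using iso normal_kernel G.marked_group_word_group[OF ls] H.marked_group_word_group[OF ls]
    by blast
qed

section \<open>A family of marked groups indexed by sets of naturals\<close>

datatype letter = Shift | Unshift | Double | Halve | Inc | Dec | Recip

instance letter :: countable by countable_datatype

fun bar :: "letter \<Rightarrow> letter" where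
  "bar Shift = Unshift"
| "bar Unshift = Shift"
| "bar Double = Halve"
| "bar Halve = Double"
| "bar Inc = Dec"
| "bar Dec = Inc"
| "bar Recip = Recip"

definition letters :: "letter list" where
  "letters = [Shift, Unshift, Double, Halve, Inc, Dec, Recip]"

lemma set_letters: "set letters = UNIV"
  by (auto simp: letters_def) (metis letter.exhaust)

fun displacement :: "letter \<Rightarrow> int" where
  "displacement Shift = 1"
| "displacement Unshift = -1"
| "displacement _ = 0"

text \<open>Since \<open>inverse 0 = 0\<close>, the letter \<open>Recip\<close> acts on \<open>\<rat>\<close> by an involution fixing \<open>0\<close>.\<close>

fun fibre_map :: "letter \<Rightarrow> nat \<Rightarrow> int \<Rightarrow> rat \<Rightarrow> rat" where
  "fibre_map Double n k x = (if k = 0 then 2 * x else x)"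
| "fibre_map Halve n k x = (if k = 0 then x / 2 else x)"
| "fibre_map Recip n k x = (if k = 0 then inverse x else x)"
| "fibre_map Inc n k x = (if k = int n then x + 1 else x)"
| "fibre_map Dec n k x = (if k = int n then x - 1 else x)"
| "fibre_map _ n k x = x"

text \<open>Fibres over \<open>n \<notin> W\<close> are still shifted, so the total displacement of
  a word can be read off for every \<open>W\<close>, even the empty one.\<close>

fun act :: "nat set \<Rightarrow> letter \<Rightarrow> nat \<times> int \<times> rat \<Rightarrow> nat \<times> int \<times> rat" where
  "act W l (n, k, x) = (n, k + displacement l, if n \<in> W then fibre_map l n k x else x)"

definition acts :: "nat set \<Rightarrow> letter list \<Rightarrow> nat \<times> int \<times> rat \<Rightarrow> nat \<times> int \<times> rat" where
  "acts W = foldr (act W)"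

lemma acts_Nil [simp]: "acts W [] = id"
  and acts_Cons [simp]: "acts W (l # w) = act W l \<circ> acts W w"
  and acts_append: "acts W (u @ v) = acts W u \<circ> acts W v"
  by (simp_all add: acts_def fun_eq_iff)

lemma act_bar: "act W (bar l) \<circ> act W l = id"
  by (rule ext, clarify, cases l) auto

lemma bar_bar: "bar (bar l) = l"
  by (cases l) auto

lemma acts_outside: "n \<notin> W \<Longrightarrow> acts W w (n, k, x) = (n, k + sum_list (map displacement w), x)"
  by (induction w) auto

lemma acts_inside: "n \<in> W \<Longrightarrow> acts W w (n, k, x) = acts UNIV w (n, k, x)"
proof (induction w)
  case (Cons l w)
  have "fst (acts UNIV w (n, k, x)) = n" by (induction w) (auto split: prod.splits simp: fst_def)
  then show ?case using Cons by (cases "acts UNIV w (n, k, x)") auto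
qed simp

lemma acts_displacement:
  "\<exists>y. acts W w (n, k, x) = (n, k + sum_list (map displacement w), y)"
  by (induction w) auto

text \<open>Over \<open>n \<in> W\<close> both sets act alike. Over other \<open>n\<close> only the
  displacement of the word matters for \<open>W\<close>, and the action for \<open>W'\<close>
  determines it.\<close>

lemma acts_factor:
  assumes "W \<subseteq> W'" and eq: "acts W' u = acts W' v"
  shows "acts W u = acts W v"
proof (rule ext, clarify)
  fix n :: nat and k :: int and x :: rat
  show "acts W u (n, k, x) = acts W v (n, k, x)"
  proof (cases "n \<in> W")
    case True
    with assms(1) have "n \<in> W'" by auto
    then show ?thesis using acts_inside[OF True] acts_inside[of n W'] eq by metis
  next
    case False
    have "sum_list (map displacement u) = sum_list (map displacement v)"
      using acts_displacement[of W' u n 0 0] acts_displacement[of W' v n 0 0] eq by auto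
    then show ?thesis by (simp add: acts_outside False)
  qed
qed

section \<open>Words moving a single fibre\<close>

definition increment_word :: "nat \<Rightarrow> letter list" where
  "increment_word n =
     Double # replicate n Unshift @ Inc # replicate n Shift @
     Halve # replicate n Unshift @ Dec # replicate n Shift"

definition reciprocal_increment_word :: "nat \<Rightarrow> letter list" where
  "reciprocal_increment_word n = Recip # increment_word n @ [Recip]"

lemma acts_replicate_Shift: "acts W (replicate j Shift) (n, k, x) = (n, k + int j, x)"
  and acts_replicate_Unshift: "acts W (replicate j Unshift) (n, k, x) = (n, k - int j, x)"
  by (induction j) auto

text \<open>Words act from right to left. Over \<open>m\<close> the shifted increment lives at
  \<open>k = int m - int n\<close> and the doubling at \<open>k = 0\<close>. For
  \<open>m \<noteq> n\<close> they commute and the commutator cancels; for \<open>m = n\<close> and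
  \<open>k = 0\<close> it is \<open>2 * ((x - 1) / 2 + 1) = x + 1\<close>.\<close>

lemma acts_increment_word:
  "acts W (increment_word n) (m, k, x) = (m, k, if m \<in> W \<and> m = n \<and> k = 0 then x + 1 else x)"
  by (auto simp: increment_word_def acts_append acts_replicate_Shift acts_replicate_Unshift
      field_simps)

lemma acts_reciprocal_increment_word:
  "acts W (reciprocal_increment_word n) (m, k, x) =
     (m, k, if m \<in> W \<and> m = n \<and> k = 0 then inverse (inverse x + 1) else x)"
  by (auto simp: reciprocal_increment_word_def acts_append acts_increment_word)

section \<open>Nonamenability of the kernels\<close>

context
  fixes ev :: "nat set \<Rightarrow> letter list \<Rightarrow> 'a"
  assumes ev_iff: "ev W u = ev W v \<longleftrightarrow> acts W u = acts W v"
begin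

lemma word_evaluation_ev: "word_evaluation (ev W) bar"
  by unfold_locales (simp_all add: ev_iff acts_append act_bar bar_bar)

lemma not_amenable_kernel:
  assumes "W \<subset> W'"
  shows "\<not> amenable ((word_group (ev W'))\<lparr>carrier := {ev W' w | w. ev W w = ev W []}\<rparr>)"
proof -
  let ?G = "word_group (ev W')" and ?N = "{ev W' w | w. ev W w = ev W []}"
  obtain n where n: "n \<in> W'" "n \<notin> W" using assms by blast
  interpret word_evaluation "ev W'" bar by (rule word_evaluation_ev)
  interpret group ?G by (rule group_word_group)
  have "?N \<lhd> ?G"
    using is_marked_quotient_word_group[OF word_evaluation_ev word_evaluation_ev set_letters, of W' W]
      acts_factor[OF psubset_imp_subset[OF assms]]
    unfolding is_marked_quotient_def ev_iff by blast
  then have "group (?G\<lparr>carrier := ?N\<rparr>)"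
    using normal_imp_subgroup subgroup_imp_group by blast
  \<comment> \<open>The orbit map of the rational \<open>0\<close> in the fibre
    \<open>(n, 0)\<close>.\<close>
  define \<theta> where "\<theta> g = snd (snd (acts W' (inv_into UNIV (ev W') g) (n, 0, 0)))" for g
  have \<theta>: "\<theta> (ev W' w) = snd (snd (acts W' w (n, 0, 0)))" for w
  proof -
    have "acts W' (inv_into UNIV (ev W') (ev W' w)) = acts W' w"
      using ev_iff by (metis f_inv_into_f rangeI)
    then show ?thesis by (simp add: \<theta>_def)
  qed
  \<comment> \<open>Since \<open>n \<notin> W\<close>, acting trivially for \<open>W\<close> forces
    displacement zero, so kernel elements keep the fibre \<open>(n, 0)\<close> in place.\<close>
  have fix_fibre: "\<exists>y. acts W' w (n, 0, 0) = (n, 0, y)" if "ev W w = ev W []" for w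
  proof -
    have "sum_list (map displacement w) = 0"
      using that acts_outside[OF n(2), of w 0 0] by (simp add: ev_iff)
    then show ?thesis using acts_displacement[of W' w n 0 0] by simp
  qed
  have "acts W (increment_word n) = id" "acts W (reciprocal_increment_word n) = id"
    using n by (auto simp: fun_eq_iff acts_increment_word acts_reciprocal_increment_word)
  then have mem: "ev W' (increment_word n) \<in> ?N" "ev W' (reciprocal_increment_word n) \<in> ?N"
    by (auto simp: ev_iff)
  show ?thesis
  proof (rule not_amenable_if_parabolic_pair[where \<theta> = \<theta>])
    show "group (?G\<lparr>carrier := ?N\<rparr>)" by fact
    show "ev W' (increment_word n) \<in> carrier (?G\<lparr>carrier := ?N\<rparr>)"
      "ev W' (reciprocal_increment_word n) \<in> carrier (?G\<lparr>carrier := ?N\<rparr>)"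
      using mem by simp_all
  next
    fix g assume "g \<in> carrier (?G\<lparr>carrier := ?N\<rparr>)"
    then obtain w where w: "g = ev W' w" "ev W w = ev W []" by auto
    show "\<theta> (ev W' (increment_word n) \<otimes>\<^bsub>?G\<lparr>carrier := ?N\<rparr>\<^esub> g) = \<theta> g + 1"
      using fix_fibre[OF w(2)] n
      by (auto simp: w(1) ev_mult \<theta> acts_append acts_increment_word)
    show "\<theta> (ev W' (reciprocal_increment_word n) \<otimes>\<^bsub>?G\<lparr>carrier := ?N\<rparr>\<^esub> g) =
        inverse (inverse (\<theta> g) + 1)"
      using fix_fibre[OF w(2)] n
      by (auto simp: w(1) ev_mult \<theta> acts_append acts_reciprocal_increment_word)
  qed
qed

end

section \<open>Realisation over the given type and the chain of values\<close>

lemma exists_evaluation: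
  assumes "infinite (UNIV :: 'a set)"
  obtains ev :: "nat set \<Rightarrow> letter list \<Rightarrow> 'a"
  where "\<And>W u v. ev W u = ev W v \<longleftrightarrow> acts W u = acts W v"
proof -
  obtain e :: "nat \<Rightarrow> 'a" where e: "inj e"
    using assms infinite_countable_subset by blast
  \<comment> \<open>There are countably many words, hence countably many transformations
    \<open>acts W w\<close>; numbering them and applying \<open>e\<close> names each by its own
    element of \<open>'a\<close>.\<close>
  define ev where "ev W w = e (to_nat_on (range (acts W)) (acts W w))" for W w
  have "ev W u = ev W v \<longleftrightarrow> acts W u = acts W v" for W u v
    using e by (simp add: ev_def inj_eq)
  then show thesis by (rule that)
qed

text \<open>Dedekind cuts: \<open>r\<close> goes to the set of indices of the rationals below
  \<open>r\<close>, and a rational between \<open>r\<close> and \<open>s\<close> separates the two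
  sets.\<close>

lemma exists_chain_nat_sets: "\<exists>\<omega> :: real \<Rightarrow> nat set. \<forall>r s. r < s \<longrightarrow> \<omega> r \<subset> \<omega> s"
proof (intro exI allI impI)
  fix r s :: real
  assume "r < s"
  then obtain q where q: "r < of_rat q" "of_rat q < s" using of_rat_dense by blast
  obtain n where "q = nat_to_rat_surj n" using surj_nat_to_rat_surj by (metis surj_def)
  then have "n \<in> {n. of_rat (nat_to_rat_surj n) < s} - {n. of_rat (nat_to_rat_surj n) < r}"
    using q by simp
  then show "{n. of_rat (nat_to_rat_surj n) < r} \<subset> {n. of_rat (nat_to_rat_surj n) < s}"
    using \<open>r < s\<close> by fastforce
qed

theorem lemma1p10:
  fixes f :: "'a monoid \<Rightarrow> 'a list \<Rightarrow> real"
  assumes "infinite (UNIV :: 'a set)"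
    and "strictly_monotone_parameter f"
  shows "\<exists>\<F> :: ('a monoid \<times> 'a list) set.
           (\<forall>(G, S)\<in>\<F>. marked_group G S) \<and>
           {f G S | G S. (G, S) \<in> \<F>} \<approx> (UNIV :: real set)"
proof -
  obtain ev :: "nat set \<Rightarrow> letter list \<Rightarrow> 'a"
    where ev: "\<And>W u v. ev W u = ev W v \<longleftrightarrow> acts W u = acts W v"
    using exists_evaluation[OF assms(1)] by blast
  note ev_eval = word_evaluation_ev[of ev, OF ev]
  obtain \<omega> :: "real \<Rightarrow> nat set" where \<omega>: "\<And>r s. r < s \<Longrightarrow> \<omega> r \<subset> \<omega> s"
    using exists_chain_nat_sets by blast
  define G where "G r = word_group (ev (\<omega> r))" for r
  define S where "S r = map (\<lambda>l. ev (\<omega> r) [l]) letters" for r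
  define N where "N r s = {ev (\<omega> s) w | w. ev (\<omega> r) w = ev (\<omega> r) []}" for r s
  have quotient: "is_marked_quotient (G s) (S s) (N r s) (G r) (S r)" if "r < s" for r s
    unfolding G_def S_def N_def
    by (rule is_marked_quotient_word_group[OF ev_eval ev_eval set_letters])
      (use acts_factor[OF psubset_imp_subset[OF \<omega>[OF that]]] ev in blast)
  have nonamenable: "\<not> amenable (G s\<lparr>carrier := N r s\<rparr>)" if "r < s" for r s
    unfolding G_def N_def by (rule not_amenable_kernel[of ev, OF ev \<omega>[OF that]])
  \<comment> \<open>For \<open>r < s\<close> the group of \<open>r\<close> is the quotient of that
    of \<open>s\<close> by the nonamenable \<open>N r s\<close>; a decreasing parameter thus
    reverses the order of the reals and an increasing one preserves it.\<close>
  have "(\<forall>r s. r < s \<longrightarrow> f (G s) (S s) < f (G r) (S r)) \<or>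
      (\<forall>r s. r < s \<longrightarrow> f (G r) (S r) < f (G s) (S s))"
    using assms(2) quotient nonamenable unfolding strictly_monotone_parameter_def by meson
  then have "inj (\<lambda>r. f (G r) (S r))"
    by (intro linorder_injI) (metis less_irrefl)
  then have "range (\<lambda>r. f (G r) (S r)) \<approx> (UNIV :: real set)"
    by (rule inj_on_image_eqpoll_self)
  moreover have "{f H T | H T. (H, T) \<in> range (\<lambda>r. (G r, S r))} = range (\<lambda>r. f (G r) (S r))"
    by auto
  moreover have "\<forall>(H, T)\<in>range (\<lambda>r. (G r, S r)). marked_group H T"
    unfolding G_def S_def
    using word_evaluation.marked_group_word_group[OF ev_eval set_letters] by auto
  ultimately show ?thesis by (intro exI[of _ "range (\<lambda>r. (G r, S r))"]) simp
qed

end
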